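(* Let $r>0$ and let $H$ be the Hankel operator with kernel $h(t)=e^{-t^r}$, i.e. the bounded self-adjoint operator $$(Hf)(t)=\int_0^\infty e^{-(t+s)^r}f(s)\,ds$$ in $L^2(\mathbb R_+)$, $\mathbb R_+=(0,\infty)$. Then $H$ is positive for $r\in(0,1]$, and it is not sign-definite for $r>1$.
   Context: "Positive" means $(Hf,f)\ge0$ for all $f\in L^2(\mathbb R_+)$. "Not sign-definite" means that neither $H\ge0$ nor $H\le0$ holds. *)

theory Defs
  imports "HOL-Analysis.Analysis"
begin

text \<open>
  The complex Hilbert space of square-integrable functions on the open half-line is represented
  by its functions rather than by classes modulo null sets.  Borel measurability loses nothing,
  since every Lebesgue measurable function agrees almost everywhere with a Borel one.  Operators
  act on representatives, so the linearity condition below is required almost everywhere only;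
  linearity together with boundedness makes them respect equality almost everywhere.
\<close>

definition half_line :: "real measure" where
  "half_line = restrict_space lborel {0<..}"

definition L2_space :: "(real \<Rightarrow> complex) set" where
  "L2_space = {f \<in> borel_measurable half_line. integrable half_line (\<lambda>t. (cmod (f t))\<^sup>2)}"

definition L2_inner :: "(real \<Rightarrow> complex) \<Rightarrow> (real \<Rightarrow> complex) \<Rightarrow> complex" where
  "L2_inner f g = (LINT t|half_line. f t * cnj (g t))"

definition L2_nrm :: "(real \<Rightarrow> complex) \<Rightarrow> real" where
  "L2_nrm f = sqrt (LINT t|half_line. (cmod (f t))\<^sup>2)"

definition L2_bounded_operator :: "((real \<Rightarrow> complex) \<Rightarrow> real \<Rightarrow> complex) \<Rightarrow> bool" where
  "L2_bounded_operator T \<longleftrightarrow>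
     (\<forall>f\<in>L2_space. T f \<in> L2_space) \<and>
     (\<forall>f\<in>L2_space. \<forall>g\<in>L2_space. \<forall>a b.
        AE t in half_line. T (\<lambda>s. a * f s + b * g s) t = a * T f t + b * T g t) \<and>
     (\<exists>C. \<forall>f\<in>L2_space. L2_nrm (T f) \<le> C * L2_nrm f)"

definition L2_selfadjoint :: "((real \<Rightarrow> complex) \<Rightarrow> real \<Rightarrow> complex) \<Rightarrow> bool" where
  "L2_selfadjoint T \<longleftrightarrow>
     (\<forall>f\<in>L2_space. \<forall>g\<in>L2_space. L2_inner (T f) g = L2_inner f (T g))"

definition L2_nonneg :: "((real \<Rightarrow> complex) \<Rightarrow> real \<Rightarrow> complex) \<Rightarrow> bool" where
  "L2_nonneg T \<longleftrightarrow> (\<forall>f\<in>L2_space. L2_inner (T f) f \<in> \<real> \<and> Re (L2_inner (T f) f) \<ge> 0)"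

definition L2_nonpos :: "((real \<Rightarrow> complex) \<Rightarrow> real \<Rightarrow> complex) \<Rightarrow> bool" where
  "L2_nonpos T \<longleftrightarrow> (\<forall>f\<in>L2_space. L2_inner (T f) f \<in> \<real> \<and> Re (L2_inner (T f) f) \<le> 0)"

definition L2_not_sign_definite :: "((real \<Rightarrow> complex) \<Rightarrow> real \<Rightarrow> complex) \<Rightarrow> bool" where
  "L2_not_sign_definite T \<longleftrightarrow> \<not> L2_nonneg T \<and> \<not> L2_nonpos T"

definition hankel :: "(real \<Rightarrow> real) \<Rightarrow> (real \<Rightarrow> complex) \<Rightarrow> real \<Rightarrow> complex" where
  "hankel h f t = (LINT s|half_line. complex_of_real (h (t + s)) * f s)"

end

theory Submission
  imports Defs
begin

text \<open>
  Since \<open>2 * (t + s) powr r \<ge> t powr r + s powr r\<close>, the kernel is dominated by the rank one kernel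
  \<open>w t * w s\<close> with \<open>w t = exp (- (t powr r) / 2)\<close> square integrable; this gives boundedness and
  justifies every use of Fubini's theorem.

  For \<open>r < 1\<close> write \<open>t powr r\<close> as a multiple of
  \<open>\<integral> (1 - exp (- x t)) x powr (- 1 - r) dx\<close> over \<open>x > 0\<close>.  Cutting the integral off near \<open>x = 0\<close>
  gives \<open>\<psi> = C - \<phi>\<close> with \<open>\<phi>\<close> the Laplace transform of a finite positive measure of mass \<open>C\<close>.
  Multiplying a kernel \<open>g (t + s)\<close> by \<open>exp (- x (t + s))\<close> preserves positivity of its quadratic form, so
  multiplying by \<open>1 - \<psi> / n = (1 - C / n) + \<phi> / n\<close> does too for \<open>n \<ge> C\<close>.  Hence \<open>(1 - \<psi> / n) ^ n\<close>
  is positive, and so are the limits \<open>exp (- \<psi>)\<close> and \<open>exp (- (t powr r))\<close>.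
\<close>

subsection \<open>Integration on the half-line\<close>

lemma space_half_line [simp]: "space half_line = {0<..}"
  by (simp add: half_line_def space_restrict_space)

lemma borel_measurable_half_lineI [measurable (raw)]:
  "f \<in> borel_measurable borel \<Longrightarrow> f \<in> borel_measurable half_line"
  unfolding half_line_def by (simp add: measurable_restrict_space1)

lemma measurable_ident_half_line [measurable]: "(\<lambda>x. x) \<in> half_line \<rightarrow>\<^sub>M borel"
  by (rule borel_measurable_half_lineI) simp

lemma sigma_finite_half_line: "sigma_finite_measure half_line"
  unfolding half_line_def by (rule sigma_finite_measure_restrict_space) (auto intro: sigma_finite_lborel)

interpretation half_line: sigma_finite_measure half_line
  by (rule sigma_finite_half_line)

interpretation half_line: pair_sigma_finite half_line half_line ..

lemma integrable_half_line_iff: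
  fixes f :: "real \<Rightarrow> 'a::{banach, second_countable_topology}"
  shows "integrable half_line f \<longleftrightarrow> integrable lborel (\<lambda>x. indicator {0<..} x *\<^sub>R f x)"
  unfolding half_line_def by (subst integrable_restrict_space) auto

lemma integral_half_line:
  fixes f :: "real \<Rightarrow> 'a::{banach, second_countable_topology}"
  shows "integral\<^sup>L half_line f = (LINT x|lborel. indicator {0<..} x *\<^sub>R f x)"
  unfolding half_line_def by (subst integral_restrict_space) auto

lemma AE_half_lineI: "(\<And>t. t > 0 \<Longrightarrow> P t) \<Longrightarrow> AE t in half_line. P t"
  by (auto intro: AE_I2)

lemma measurable_fst_half_line: "fst \<in> borel_measurable (half_line \<Otimes>\<^sub>M N)"
  using measurable_compose[OF measurable_fst measurable_ident_half_line] by simp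

lemma measurable_snd_half_line: "snd \<in> borel_measurable (N \<Otimes>\<^sub>M half_line)"
  using measurable_compose[OF measurable_snd measurable_ident_half_line] by simp

text \<open>Stated for general factors because it serves both the quadrant and the product of the
  half-line with the quadrant.\<close>

lemma (in pair_sigma_finite) integrable_prod:
  fixes f g :: "_ \<Rightarrow> real"
  assumes f: "integrable M1 f" and g: "integrable M2 g"
  shows "integrable (M1 \<Otimes>\<^sub>M M2) (\<lambda>p. f (fst p) * g (snd p))"
proof (rule Fubini_integrable)
  have [measurable]: "f \<in> borel_measurable M1" "g \<in> borel_measurable M2" using f g by auto
  show "(\<lambda>p. f (fst p) * g (snd p)) \<in> borel_measurable (M1 \<Otimes>\<^sub>M M2)" by measurable
  show "integrable M1 (\<lambda>x. \<integral> y. norm (f (fst (x, y)) * g (snd (x, y))) \<partial>M2)"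
    using f by (simp add: abs_mult)
  show "AE x in M1. integrable M2 (\<lambda>y. f (fst (x, y)) * g (snd (x, y)))"
    using g by simp
qed

lemma (in pair_sigma_finite) integral_prod:
  fixes f g :: "_ \<Rightarrow> real"
  assumes f: "integrable M1 f" and g: "integrable M2 g"
  shows "(\<integral>p. f (fst p) * g (snd p) \<partial>(M1 \<Otimes>\<^sub>M M2)) = integral\<^sup>L M1 f * integral\<^sup>L M2 g"
  by (subst integral_fst'[symmetric, OF integrable_prod[OF f g]]) simp

lemma integrable_prod_square:
  fixes u v :: "'a \<Rightarrow> real"
  assumes [measurable]: "u \<in> borel_measurable M" "v \<in> borel_measurable M"
    and u: "integrable M (\<lambda>x. (u x)\<^sup>2)" and v: "integrable M (\<lambda>x. (v x)\<^sup>2)"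
  shows "integrable M (\<lambda>x. u x * v x)"
proof (rule Bochner_Integration.integrable_bound)
  show "integrable M (\<lambda>x. (u x)\<^sup>2 + (v x)\<^sup>2)" using u v by simp
  show "AE x in M. norm (u x * v x) \<le> norm ((u x)\<^sup>2 + (v x)\<^sup>2)"
  proof (rule AE_I2)
    fix x
    have "2 * (\<bar>u x\<bar> * \<bar>v x\<bar>) \<le> (u x)\<^sup>2 + (v x)\<^sup>2"
      using sum_squares_bound[of "\<bar>u x\<bar>" "\<bar>v x\<bar>"] by simp
    moreover have "0 \<le> \<bar>u x\<bar> * \<bar>v x\<bar>" by simp
    ultimately have "\<bar>u x\<bar> * \<bar>v x\<bar> \<le> (u x)\<^sup>2 + (v x)\<^sup>2" by linarith
    then show "norm (u x * v x) \<le> norm ((u x)\<^sup>2 + (v x)\<^sup>2)" by (simp add: abs_mult)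
  qed
qed simp

text \<open>Transferred from the inequality for nonnegative integrals; square integrability makes
  all the integrals involved finite, so they can be read as real numbers.\<close>

lemma Cauchy_Schwarz_integral:
  fixes u v :: "'a \<Rightarrow> real"
  assumes [measurable]: "u \<in> borel_measurable M" "v \<in> borel_measurable M"
    and u: "integrable M (\<lambda>x. (u x)\<^sup>2)" and v: "integrable M (\<lambda>x. (v x)\<^sup>2)"
  shows "(LINT x|M. \<bar>u x\<bar> * \<bar>v x\<bar>)\<^sup>2 \<le> (LINT x|M. (u x)\<^sup>2) * (LINT x|M. (v x)\<^sup>2)"
proof -
  have i: "integrable M (\<lambda>x. \<bar>u x\<bar> * \<bar>v x\<bar>)"
    using integrable_prod_square[of "\<lambda>x. \<bar>u x\<bar>" M "\<lambda>x. \<bar>v x\<bar>"] u v by simp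
  have e: "(\<integral>\<^sup>+x. ennreal \<bar>u x\<bar> * ennreal \<bar>v x\<bar> \<partial>M) = ennreal (LINT x|M. \<bar>u x\<bar> * \<bar>v x\<bar>)"
    using nn_integral_eq_integral[OF i] by (simp add: ennreal_mult)
  have e2: "(\<integral>\<^sup>+x. (ennreal \<bar>w x\<bar>)\<^sup>2 \<partial>M) = ennreal (LINT x|M. (w x)\<^sup>2)"
    if "integrable M (\<lambda>x. (w x)\<^sup>2)" for w :: "'a \<Rightarrow> real"
    using nn_integral_eq_integral[OF that] by (simp add: ennreal_power)
  have "(\<integral>\<^sup>+x. ennreal \<bar>u x\<bar> * ennreal \<bar>v x\<bar> \<partial>M)\<^sup>2
      \<le> (\<integral>\<^sup>+x. (ennreal \<bar>u x\<bar>)\<^sup>2 \<partial>M) * (\<integral>\<^sup>+x. (ennreal \<bar>v x\<bar>)\<^sup>2 \<partial>M)"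
    by (rule Cauchy_Schwarz_nn_integral) measurable
  then have "ennreal ((LINT x|M. \<bar>u x\<bar> * \<bar>v x\<bar>)\<^sup>2) \<le> ennreal ((LINT x|M. (u x)\<^sup>2) * (LINT x|M. (v x)\<^sup>2))"
    unfolding e e2[OF u] e2[OF v] by (simp add: ennreal_power ennreal_mult)
  then show ?thesis by (simp add: ennreal_le_iff)
qed

section \<open>Integrability by comparison with powers at 0 and at infinity\<close>

lemma integrable_half_line_powr_cut:
  fixes a b :: real
  assumes "a > -1" "b < -1"
  shows "integrable half_line (\<lambda>x. if x \<le> 1 then x powr a else x powr b)"
proof -
  have 1: "set_integrable lborel {0<..1} (\<lambda>x. x powr a)"
  proof -
    have "(\<lambda>x. x powr a) absolutely_integrable_on {0<..1}"
      by (intro nonnegative_absolutely_integrable_1 integrable_on_powr_from_0') (use assms in auto)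
    \<comment> \<open>Absolute integrability refers to Lebesgue measure, the completion of
      \<open>lborel\<close>; for a Borel function the two notions of integrability coincide.\<close>
    then show ?thesis
      unfolding set_integrable_def by (subst (asm) integrable_completion) auto
  qed
  have 2: "set_integrable lborel {1..} (\<lambda>x. x powr b)"
  proof -
    have "(\<lambda>x. x powr b) integrable_on {1..}"
      using has_integral_powr_to_inf[of b 1] assms by (auto simp: integrable_on_def)
    then have "(\<lambda>x. x powr b) absolutely_integrable_on {1..}"
      by (intro nonnegative_absolutely_integrable_1) auto
    then show ?thesis
      unfolding set_integrable_def by (subst (asm) integrable_completion) auto
  qed
  \<comment> \<open>Removing the endpoint 1 makes the two pieces disjoint, so the two restricted
    functions add up to the case distinction.\<close>
  have 3: "set_integrable lborel {1<..} (\<lambda>x. x powr b)"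
    by (rule set_integrable_subset[OF 2]) auto
  show ?thesis
    unfolding integrable_half_line_iff
    by (rule Bochner_Integration.integrable_cong[THEN iffD1, OF refl _
          Bochner_Integration.integrable_add[OF 1[unfolded set_integrable_def] 3[unfolded set_integrable_def]]])
       (auto simp: indicator_def)
qed

lemma integrable_half_line_cut_bound:
  fixes f :: "real \<Rightarrow> 'a::{banach, second_countable_topology}"
  assumes "f \<in> borel_measurable half_line" "a > -1" "b < -1"
    and "\<And>x. 0 < x \<Longrightarrow> x \<le> 1 \<Longrightarrow> norm (f x) \<le> C * x powr a"
    and "\<And>x. 1 < x \<Longrightarrow> norm (f x) \<le> C * x powr b"
  shows "integrable half_line f"
proof (rule Bochner_Integration.integrable_bound)
  show "integrable half_line (\<lambda>x. C * (if x \<le> 1 then x powr a else x powr b))"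
    using integrable_half_line_powr_cut[OF assms(2,3)] by simp
  show "AE x in half_line. norm (f x) \<le> norm (C * (if x \<le> 1 then x powr a else x powr b))"
    using assms(4,5) by (intro AE_half_lineI) (auto intro: order_trans[OF _ abs_ge_self])
qed (use assms in auto)

text \<open>A single term of the exponential series bounds \<open>exp u\<close> from below, since
  all terms are nonnegative. This gives decay faster than any chosen power.\<close>

lemma exp_neg_le_fact_div_power:
  fixes u :: real
  assumes "u > 0"
  shows "exp (- u) \<le> fact n / u ^ n"
proof -
  have "u ^ n / fact n \<le> exp u"
  proof -
    have "(\<Sum>k\<in>{n}. u ^ k /\<^sub>R fact k) \<le> (\<Sum>k. u ^ k /\<^sub>R fact k)"
      by (rule sum_le_suminf[OF summable_exp_generic]) (use assms in auto)
    then show ?thesis by (simp add: exp_def divide_inverse mult.commute)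
  qed
  then show ?thesis using assms by (simp add: exp_minus field_simps)
qed

lemma integrable_exp_neg_powr:
  fixes r :: real
  assumes "r > 0"
  shows "integrable half_line (\<lambda>t. exp (- (t powr r)))"
proof -
  \<comment> \<open>This choice puts the exponent \<open>- (r * real n)\<close> of the majorant at
    infinity below -1.\<close>
  obtain n where n: "real n > 2 / r" using reals_Archimedean2 by blast
  then have rn: "r * real n > 2" using assms by (simp add: field_simps)
  have f1: "(fact n :: real) \<ge> 1" by (rule fact_ge_1)
  show ?thesis
  proof (rule integrable_half_line_cut_bound[where C = "fact n" and a = 0 and b = "- (r * real n)"])
    fix x :: real assume x: "0 < x" "x \<le> 1"
    have "exp (- (x powr r)) \<le> 1" by simp
    from order_trans[OF this f1] show "norm (exp (- (x powr r))) \<le> fact n * x powr 0" using x by simp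
  next
    fix x :: real assume x: "1 < x"
    have "exp (- (x powr r)) \<le> fact n / (x powr r) ^ n"
      by (rule exp_neg_le_fact_div_power) (use x in auto)
    also have "(x powr r) ^ n = x powr (r * real n)"
      using x by (simp add: powr_powr flip: powr_realpow)
    finally show "norm (exp (- (x powr r))) \<le> fact n * x powr (- (r * real n))"
      by (simp add: powr_minus divide_inverse)
  qed (use rn in auto)
qed

lemma half_line_Ioc:
  fixes a b :: real
  assumes "0 \<le> a" "a \<le> b"
  shows "integrable half_line (indicator {a<..b} :: real \<Rightarrow> real)"
    and "(LINT t|half_line. indicator {a<..b} t) = b - a"
proof -
  have eq: "indicator {0<..} t *\<^sub>R indicator {a<..b} t = (indicator {a<..b} t :: real)" for t
    using assms by (auto simp: indicator_def)
  show "integrable half_line (indicator {a<..b} :: real \<Rightarrow> real)"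
    unfolding integrable_half_line_iff eq
    by (rule integrable_real_indicator) (use assms in auto)
  show "(LINT t|half_line. indicator {a<..b} t) = b - a"
    unfolding integral_half_line eq using assms by simp
qed

subsection \<open>Positive quadratic forms on integrable functions\<close>

abbreviation quadrant :: "(real \<times> real) measure" where
  "quadrant \<equiv> half_line \<Otimes>\<^sub>M half_line"

lemma measurable_add_quadrant [measurable]: "(\<lambda>p. fst p + snd p) \<in> borel_measurable quadrant"
  using measurable_fst_half_line measurable_snd_half_line by (rule borel_measurable_add)

lemma AE_quadrantI: "(\<And>t s. t > 0 \<Longrightarrow> s > 0 \<Longrightarrow> P (t, s)) \<Longrightarrow> AE p in quadrant. P p"
  by (rule AE_I2) (auto simp: space_pair_measure)

text \<open>On complex numbers \<open>x \<bullet> y\<close> is \<open>Re (x * cnj y)\<close>, so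
  this is the real part of the quadratic form of the Hankel operator. For the dominated kernels
  below and square integrable \<open>f\<close> that form is real, so nothing is lost.\<close>

definition hankel_form :: "(real \<Rightarrow> real) \<Rightarrow> (real \<Rightarrow> complex) \<Rightarrow> real" where
  "hankel_form g f = (LINT p|quadrant. g (fst p + snd p) * (f (fst p) \<bullet> f (snd p)))"

text \<open>The test functions are integrable rather than square integrable: kernels such as the
  constant 1, where the construction starts, have no form on all of the Hilbert space. The bound 1
  makes the form converge absolutely for integrable \<open>f\<close>, and it survives products and
  pointwise limits.\<close>

definition hankel_pd :: "(real \<Rightarrow> real) \<Rightarrow> bool" where
  "hankel_pd g \<longleftrightarrow> g \<in> borel_measurable borel \<and> (\<forall>t>0. \<bar>g t\<bar> \<le> 1)
     \<and> (\<forall>f. integrable half_line f \<longrightarrow> 0 \<le> hankel_form g f)"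

lemma measurable_hankel_integrand:
  fixes f :: "real \<Rightarrow> complex"
  assumes [measurable]: "g \<in> borel_measurable borel" "f \<in> borel_measurable half_line"
  shows "(\<lambda>p. g (fst p + snd p) * (f (fst p) \<bullet> f (snd p))) \<in> borel_measurable quadrant"
  by measurable

lemma integrable_inner_quadrant:
  fixes f :: "real \<Rightarrow> complex"
  assumes f: "integrable half_line f"
  shows "integrable quadrant (\<lambda>p. norm (f (fst p)) * norm (f (snd p)))"
  by (rule half_line.integrable_prod) (use f in auto)

lemma abs_mult_inner_le:
  fixes x y :: "'a::real_inner"
  assumes "\<bar>c\<bar> \<le> 1"
  shows "\<bar>c * (x \<bullet> y)\<bar> \<le> norm x * norm y"
proof -
  have "\<bar>c * (x \<bullet> y)\<bar> \<le> 1 * (norm x * norm y)"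
    unfolding abs_mult by (intro mult_mono assms Cauchy_Schwarz_ineq2) auto
  then show ?thesis by simp
qed

lemma integrable_hankel_integrand:
  fixes f :: "real \<Rightarrow> complex"
  assumes g: "g \<in> borel_measurable borel" "\<And>t. t > 0 \<Longrightarrow> \<bar>g t\<bar> \<le> 1"
    and f: "integrable half_line f"
  shows "integrable quadrant (\<lambda>p. g (fst p + snd p) * (f (fst p) \<bullet> f (snd p)))"
proof (rule Bochner_Integration.integrable_bound[OF integrable_inner_quadrant[OF f]])
  show "AE p in quadrant. norm (g (fst p + snd p) * (f (fst p) \<bullet> f (snd p)))
      \<le> norm (norm (f (fst p)) * norm (f (snd p)))"
    by (rule AE_quadrantI) (auto simp: abs_mult_inner_le g)
qed (use assms in \<open>auto intro: measurable_hankel_integrand\<close>)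

text \<open>By Fubini the form factors into the squared modulus of the integral of
  \<open>f\<close>.\<close>

lemma hankel_pd_one: "hankel_pd (\<lambda>_. 1)"
proof -
  have "0 \<le> hankel_form (\<lambda>_. 1) f" if f: "integrable half_line f" for f
  proof -
    have i: "integrable quadrant (\<lambda>p. f (fst p) \<bullet> f (snd p))"
      using integrable_hankel_integrand[of "\<lambda>_. 1", OF _ _ f] by simp
    have "hankel_form (\<lambda>_. 1) f = (LINT t|half_line. LINT s|half_line. f t \<bullet> f s)"
      unfolding hankel_form_def using half_line.integral_fst'[OF i] by simp
    also have "\<dots> = (LINT t|half_line. f t) \<bullet> (LINT s|half_line. f s)"
      using f by simp
    finally show ?thesis by simp
  qed
  then show ?thesis by (simp add: hankel_pd_def)
qed

text \<open>The exponential of a sum splits into one factor in each variable, and each is absorbed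
  by the corresponding copy of \<open>f\<close>.\<close>

lemma hankel_form_exp_mult:
  "hankel_form (\<lambda>t. g t * exp (- (x * t))) f = hankel_form g (\<lambda>t. exp (- (x * t)) *\<^sub>R f t)"
  unfolding hankel_form_def
  by (rule Bochner_Integration.integral_cong) (auto simp: distrib_left exp_add exp_diff exp_minus field_simps)

lemma integrable_exp_scaleR:
  fixes f :: "real \<Rightarrow> 'a::{banach, second_countable_topology}"
  assumes f: "integrable half_line f" and x: "x \<ge> 0"
  shows "integrable half_line (\<lambda>t. exp (- (x * t)) *\<^sub>R f t)"
proof (rule Bochner_Integration.integrable_bound[OF f])
  have [measurable]: "f \<in> borel_measurable half_line" using f by simp
  show "(\<lambda>t. exp (- (x * t)) *\<^sub>R f t) \<in> borel_measurable half_line" by measurable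
  show "AE t in half_line. norm (exp (- (x * t)) *\<^sub>R f t) \<le> norm (f t)"
    using x by (intro AE_half_lineI) (auto intro!: mult_left_le_one_le)
qed

lemma hankel_pd_exp_mult:
  assumes g: "hankel_pd g" and x: "x \<ge> 0"
  shows "hankel_pd (\<lambda>t. g t * exp (- (x * t)))"
proof -
  have [measurable]: "g \<in> borel_measurable borel" using g by (simp add: hankel_pd_def)
  have "\<bar>g t * exp (- (x * t))\<bar> \<le> 1" if "t > 0" for t
    using g x that by (auto simp: hankel_pd_def abs_mult intro!: mult_le_one)
  then show ?thesis
    using g x by (auto simp: hankel_pd_def hankel_form_exp_mult integrable_exp_scaleR)
qed

section \<open>Multiplication by Laplace transforms and the exponential limit\<close>

definition laplace :: "(real \<Rightarrow> real) \<Rightarrow> real \<Rightarrow> real" where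
  "laplace k t = (LINT x|half_line. k x * exp (- (x * t)))"

lemma measurable_laplace [measurable]:
  assumes [measurable]: "k \<in> borel_measurable half_line"
  shows "laplace k \<in> borel_measurable borel"
  unfolding laplace_def by measurable

lemma integrable_laplace:
  assumes k: "integrable half_line k" and t: "t > 0"
  shows "integrable half_line (\<lambda>x. k x * exp (- (x * t)))"
  using integrable_exp_scaleR[OF k, of t] t by (simp add: mult.commute)

text \<open>The new kernel is a superposition, with weight \<open>k x \<ge> 0\<close>, of the
  kernels treated in \<open>hankel_pd_exp_mult\<close>. Fubini moves the integral over
  \<open>x\<close> outside the form.\<close>

lemma hankel_form_laplace_nonneg:
  assumes g: "hankel_pd g" and k: "integrable half_line k" "\<And>x. x > 0 \<Longrightarrow> k x \<ge> 0"
    and f: "integrable half_line f"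
  shows "0 \<le> hankel_form (\<lambda>t. g t * laplace k t) f"
proof -
  have [measurable]: "g \<in> borel_measurable borel" "k \<in> borel_measurable half_line"
    "f \<in> borel_measurable half_line"
    using g k f by (auto simp: hankel_pd_def)
  interpret R: pair_sigma_finite half_line quadrant ..
  define F where "F x p = k x * (g (fst p + snd p) * exp (- (x * (fst p + snd p))) * (f (fst p) \<bullet> f (snd p)))"
    for x :: real and p :: "real \<times> real"
  have [measurable]: "case_prod F \<in> borel_measurable (half_line \<Otimes>\<^sub>M quadrant)"
    unfolding F_def by measurable
  \<comment> \<open>Joint integrability over all three variables justifies Fubini; the majorant is
    \<open>k x\<close> times the norms of \<open>f\<close> at the two points, because the kernel
    times the exponential is still bounded by 1.\<close>
  have F: "integrable (half_line \<Otimes>\<^sub>M quadrant) (case_prod F)"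
  proof (rule Bochner_Integration.integrable_bound)
    show "integrable (half_line \<Otimes>\<^sub>M quadrant)
       (\<lambda>q. k (fst q) * (norm (f (fst (snd q))) * norm (f (snd (snd q)))))"
      by (rule R.integrable_prod[OF k(1) integrable_inner_quadrant[OF f]])
    have "\<bar>F x (t, s)\<bar> \<le> k x * (norm (f t) * norm (f s))" if "x > 0" "t > 0" "s > 0" for x t s
    proof -
      have "\<bar>g (t + s) * exp (- (x * (t + s)))\<bar> \<le> 1"
        using hankel_pd_exp_mult[OF g, of x] that by (auto simp: hankel_pd_def)
      then show ?thesis
        unfolding F_def using k(2)[OF that(1)]
        by (subst abs_mult) (auto intro!: mult_left_mono abs_mult_inner_le)
    qed
    then show "AE q in half_line \<Otimes>\<^sub>M quadrant. norm (case_prod F q)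
       \<le> norm (k (fst q) * (norm (f (fst (snd q))) * norm (f (snd (snd q)))))"
      by (intro AE_I2) (auto simp: space_pair_measure intro: order_trans[OF _ abs_ge_self])
  qed measurable
  have "hankel_form (\<lambda>t. g t * laplace k t) f = (LINT p|quadrant. LINT x|half_line. F x p)"
    unfolding hankel_form_def
  proof (rule Bochner_Integration.integral_cong)
    fix p assume "p \<in> space quadrant"
    show "g (fst p + snd p) * laplace k (fst p + snd p) * (f (fst p) \<bullet> f (snd p))
       = (LINT x|half_line. F x p)"
    proof -
      have "(LINT x|half_line. F x p) = (LINT x|half_line.
          (g (fst p + snd p) * (f (fst p) \<bullet> f (snd p))) * (k x * exp (- (x * (fst p + snd p)))))"
        unfolding F_def by (rule Bochner_Integration.integral_cong) (auto simp: algebra_simps)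
      then show ?thesis by (simp add: laplace_def)
    qed
  qed simp
  also have "\<dots> = (LINT x|half_line. LINT p|quadrant. F x p)"
    by (rule R.Fubini_integral[OF F])
  also have "\<dots> = (LINT x|half_line. k x * hankel_form (\<lambda>t. g t * exp (- (x * t))) f)"
    unfolding hankel_form_def F_def by simp
  also have "\<dots> \<ge> 0"
    using k(2) hankel_pd_exp_mult[OF g] f
    by (intro integral_nonneg_AE AE_half_lineI mult_nonneg_nonneg) (auto simp: hankel_pd_def less_imp_le)
  finally show ?thesis .
qed

lemma laplace_bounds:
  assumes k: "integrable half_line k" "\<And>x. x > 0 \<Longrightarrow> k x \<ge> 0" and t: "t > 0"
  shows "0 \<le> laplace k t" "laplace k t \<le> integral\<^sup>L half_line k"
proof -
  show "0 \<le> laplace k t"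
    unfolding laplace_def using k by (intro integral_nonneg_AE AE_half_lineI) auto
  show "laplace k t \<le> integral\<^sup>L half_line k"
    unfolding laplace_def
    using k t by (intro integral_mono_AE integrable_laplace AE_half_lineI) (auto intro!: mult_right_le_one_le)
qed

text \<open>The form is \<open>a\<close> times that of \<open>g\<close> plus a Laplace multiple. The
  bound on \<open>a\<close> plus the mass of \<open>k\<close> keeps the multiplier in [0, 1], so the
  bound required by \<open>hankel_pd\<close> is preserved.\<close>

lemma hankel_pd_mult_laplace:
  assumes g: "hankel_pd g" and k: "integrable half_line k" "\<And>x. x > 0 \<Longrightarrow> k x \<ge> 0"
    and a: "a \<ge> 0" "a + integral\<^sup>L half_line k \<le> 1"
  shows "hankel_pd (\<lambda>t. g t * (a + laplace k t))"
proof -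
  have gm [measurable]: "g \<in> borel_measurable borel" "k \<in> borel_measurable half_line"
    and gb: "\<And>t. t > 0 \<Longrightarrow> \<bar>g t\<bar> \<le> 1"
    using g k by (auto simp: hankel_pd_def)
  have lb: "\<bar>laplace k t\<bar> \<le> 1" "\<bar>a + laplace k t\<bar> \<le> 1" if "t > 0" for t
    using laplace_bounds[OF k that] a by auto
  have glb: "\<bar>g t * laplace k t\<bar> \<le> 1" "\<bar>g t * (a + laplace k t)\<bar> \<le> 1" if "t > 0" for t
    unfolding abs_mult using gb lb that by (auto intro!: mult_le_one)
  have "0 \<le> hankel_form (\<lambda>t. g t * (a + laplace k t)) f" if f: "integrable half_line f" for f
  proof -
    have "hankel_form (\<lambda>t. g t * (a + laplace k t)) f
       = (LINT p|quadrant. a * (g (fst p + snd p) * (f (fst p) \<bullet> f (snd p)))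
           + g (fst p + snd p) * laplace k (fst p + snd p) * (f (fst p) \<bullet> f (snd p)))"
      unfolding hankel_form_def by (rule Bochner_Integration.integral_cong) (auto simp: algebra_simps)
    also have "\<dots> = a * hankel_form g f + hankel_form (\<lambda>t. g t * laplace k t) f"
      unfolding hankel_form_def
      using integrable_hankel_integrand[OF gm(1) gb f]
        integrable_hankel_integrand[of "\<lambda>t. g t * laplace k t", OF _ glb(1) f]
      by (subst Bochner_Integration.integral_add) auto
    also have "\<dots> \<ge> 0"
      using hankel_form_laplace_nonneg[OF g k f] g f a by (auto simp: hankel_pd_def)
    finally show ?thesis .
  qed
  then show ?thesis using glb by (simp add: hankel_pd_def)
qed

text \<open>The common bound 1 provides a majorant independent of \<open>n\<close>, so pointwise
  convergence on the half-line is enough for dominated convergence of the forms.\<close>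

lemma hankel_pd_LIMSEQ:
  assumes g: "\<And>n. hankel_pd (g n)" and [measurable]: "G \<in> borel_measurable borel"
    and lim: "\<And>t. t > 0 \<Longrightarrow> (\<lambda>n. g n t) \<longlonglongrightarrow> G t"
  shows "hankel_pd G"
proof -
  have gm [measurable]: "g n \<in> borel_measurable borel" for n
    using g by (auto simp: hankel_pd_def)
  have gb: "\<bar>g n t\<bar> \<le> 1" if "t > 0" for n t
    using g that by (auto simp: hankel_pd_def)
  have Gb: "\<bar>G t\<bar> \<le> 1" if "t > 0" for t
    by (rule LIMSEQ_le_const2[OF tendsto_rabs[OF lim[OF that]]]) (use gb that in auto)
  have "0 \<le> hankel_form G f" if f: "integrable half_line f" for f
  proof -
    have [measurable]: "f \<in> borel_measurable half_line" using f by simp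
    have "(\<lambda>n. hankel_form (g n) f) \<longlonglongrightarrow> hankel_form G f"
      unfolding hankel_form_def
    proof (rule integral_dominated_convergence[OF _ _ integrable_inner_quadrant[OF f]])
      show "AE p in quadrant. (\<lambda>n. g n (fst p + snd p) * (f (fst p) \<bullet> f (snd p)))
          \<longlonglongrightarrow> G (fst p + snd p) * (f (fst p) \<bullet> f (snd p))"
        by (rule AE_quadrantI) (auto intro!: tendsto_intros lim)
      show "AE p in quadrant. norm (g n (fst p + snd p) * (f (fst p) \<bullet> f (snd p)))
          \<le> norm (f (fst p)) * norm (f (snd p))" for n
        by (rule AE_quadrantI) (auto intro!: abs_mult_inner_le gb)
    qed measurable
    then show ?thesis
      by (rule LIMSEQ_le_const) (use g f in \<open>auto simp: hankel_pd_def\<close>)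
  qed
  then show ?thesis using Gb by (simp add: hankel_pd_def)
qed

text \<open>Uses the limit of \<open>(1 + y / n) ^ n\<close> with
  \<open>y = laplace k t - C\<close>. Each factor regroups as the constant \<open>1 - C / n\<close>
  plus the Laplace transform of \<open>k / n\<close>, and the constant and the mass add up to
  exactly 1.\<close>

lemma hankel_pd_exp_laplace:
  assumes k: "integrable half_line k" "\<And>x. x > 0 \<Longrightarrow> k x \<ge> 0"
  shows "hankel_pd (\<lambda>t. exp (laplace k t - integral\<^sup>L half_line k))"
proof -
  have [measurable]: "k \<in> borel_measurable half_line" using k by simp
  define C where "C = integral\<^sup>L half_line k"
  have C0: "C \<ge> 0" unfolding C_def using k by (intro integral_nonneg_AE AE_half_lineI) auto
  obtain N :: nat where N: "real N > C" using reals_Archimedean2 by blast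
  \<comment> \<open>The exponent \<open>m\<close> is kept apart from \<open>n\<close> so that the
    induction runs over a fixed factor; afterwards \<open>m\<close> is set equal to
    \<open>n\<close>.\<close>
  have pow: "hankel_pd (\<lambda>t. ((1 - C / n) + laplace (\<lambda>x. k x / n) t) ^ m)" if n: "n \<ge> N" for n m :: nat
  proof (induction m)
    case 0
    show ?case by (simp add: hankel_pd_one)
  next
    case (Suc m)
    have n0: "real n > 0" "real n \<ge> C" using n N C0 by linarith+
    have "hankel_pd (\<lambda>t. ((1 - C / n) + laplace (\<lambda>x. k x / n) t) ^ m * ((1 - C / n) + laplace (\<lambda>x. k x / n) t))"
      by (rule hankel_pd_mult_laplace[OF Suc]) (use k n0 in \<open>auto simp: C_def\<close>)
    then show ?case by (simp add: mult.commute)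
  qed
  have lap: "laplace (\<lambda>x. k x / n) t = laplace k t / n" for n :: nat and t
    unfolding laplace_def by (subst Bochner_Integration.integral_divide_zero[symmetric]) simp
  show ?thesis
  proof (rule hankel_pd_LIMSEQ)
    \<comment> \<open>The shift by \<open>N\<close> skips the indices below \<open>C\<close>, for
      which the constant \<open>1 - C / n\<close> would be negative.\<close>
    show "hankel_pd (\<lambda>t. (1 + (laplace k t - C) / real (n + N)) ^ (n + N))" for n
      using pow[of "n + N" "n + N"] unfolding lap by (simp add: diff_divide_distrib algebra_simps)
    show "(\<lambda>n. (1 + (laplace k t - C) / real (n + N)) ^ (n + N)) \<longlonglongrightarrow> exp (laplace k t - integral\<^sup>L half_line k)" for t
      using LIMSEQ_ignore_initial_segment[OF tendsto_exp_limit_sequentially[of "laplace k t - C"], of N]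
      by (simp add: C_def)
  qed measurable
qed

section \<open>The integral representation of \<open>t powr r\<close>\<close>

lemma one_minus_exp_neg_le:
  fixes x :: real
  shows "x \<ge> 0 \<Longrightarrow> \<bar>1 - exp (- x)\<bar> \<le> x" "x \<ge> 0 \<Longrightarrow> \<bar>1 - exp (- x)\<bar> \<le> 1"
  using exp_ge_add_one_self[of "- x"] by (auto simp: abs_if)

text \<open>The integrand is at most \<open>x powr (- r)\<close> near 0 and at most
  \<open>x powr (- 1 - r)\<close> at infinity; for 0 < r < 1 these exponents lie on the right sides
  of -1.\<close>

lemma integrable_one_minus_exp_powr:
  fixes r :: real
  assumes "0 < r" "r < 1"
  shows "integrable half_line (\<lambda>x. (1 - exp (- x)) * x powr (- 1 - r))"
proof (rule integrable_half_line_cut_bound[where C = 1 and a = "- r" and b = "- 1 - r"])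
  fix x :: real assume x: "0 < x" "x \<le> 1"
  have "x * x powr (- 1 - r) = x powr (- r)"
    using x powr_add[of x 1 "- 1 - r"] by simp
  then show "norm ((1 - exp (- x)) * x powr (- 1 - r)) \<le> 1 * x powr (- r)"
    using mult_right_mono[OF one_minus_exp_neg_le(1)[of x], of "x powr (- 1 - r)"] x
    by (simp add: abs_mult)
next
  fix x :: real assume "1 < x"
  then show "norm ((1 - exp (- x)) * x powr (- 1 - r)) \<le> 1 * x powr (- 1 - r)"
    using mult_right_mono[OF one_minus_exp_neg_le(2)[of x], of "x powr (- 1 - r)"]
    by (simp add: abs_mult)
qed (use assms in auto)

text \<open>Allows the representation to be normalised by dividing by this integral. On (1/2, 1]
  both factors are bounded below, so a positive step function lies under the integrand.\<close>

lemma integral_one_minus_exp_powr_pos: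
  fixes r :: real
  assumes "0 < r" "r < 1"
  shows "0 < (LINT x|half_line. (1 - exp (- x)) * x powr (- 1 - r))"
proof -
  let ?J = "\<lambda>x::real. (1 - exp (- x)) * x powr (- 1 - r)"
  have le: "(1 - exp (- (1 / 2))) * indicator {1/2<..1} x \<le> ?J x" if x: "x > 0" for x
  proof (cases "x \<in> {1/2<..1}")
    case True
    then have "1 powr (- 1 - r) \<le> x powr (- 1 - r)"
      using assms x by (intro powr_mono2') auto
    then have "(1 - exp (- (1 / 2))) * 1 \<le> ?J x"
      using True by (intro mult_mono) auto
    then show ?thesis using True by simp
  qed (use x in auto)
  have "0 < (LINT x|half_line. (1 - exp (- (1 / 2)) :: real) * indicator {1/2<..1::real} x)"
    by (subst integral_mult_right_zero, subst half_line_Ioc(2)) auto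
  also have "\<dots> \<le> integral\<^sup>L half_line ?J"
    by (intro integral_mono_AE integrable_mult_right half_line_Ioc integrable_one_minus_exp_powr AE_half_lineI le)
      (use assms in auto)
  finally show ?thesis .
qed

text \<open>Homogeneity: substitute \<open>t * x\<close> for \<open>x\<close> in the integral with
  parameter 1. The Jacobian \<open>t\<close> and the factor \<open>t powr (- 1 - r)\<close> combine
  to \<open>t powr (- r)\<close>.\<close>

lemma scaled_one_minus_exp_powr:
  fixes r t :: real
  assumes r: "0 < r" "r < 1" and t: "t > 0"
  shows "integrable half_line (\<lambda>x. (1 - exp (- (x * t))) * x powr (- 1 - r))"
    and "(LINT x|half_line. (1 - exp (- (x * t))) * x powr (- 1 - r))
       = t powr r * (LINT x|half_line. (1 - exp (- x)) * x powr (- 1 - r))"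
proof -
  let ?J = "\<lambda>x::real. indicator {0<..} x *\<^sub>R ((1 - exp (- x)) * x powr (- 1 - r))"
  let ?J' = "\<lambda>x::real. indicator {0<..} x *\<^sub>R ((1 - exp (- (x * t))) * x powr (- 1 - r))"
  \<comment> \<open>The summand 0 matches the form of the affine change of variables.\<close>
  have eq: "?J (0 + t * x) = t powr (- 1 - r) * ?J' x" for x
    using t by (auto simp: indicator_def powr_mult zero_less_mult_iff mult.commute)
  have J: "integrable lborel ?J"
    using integrable_one_minus_exp_powr[OF r] by (simp add: integrable_half_line_iff)
  have "integrable lborel (\<lambda>x. ?J (0 + t * x))"
    by (rule lborel_integrable_real_affine[OF J]) (use t in simp)
  then show "integrable half_line (\<lambda>x. (1 - exp (- (x * t))) * x powr (- 1 - r))"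
    unfolding eq integrable_half_line_iff using t by simp
  have "integral\<^sup>L lborel ?J = t * (t powr (- 1 - r) * integral\<^sup>L lborel ?J')"
    using lborel_integral_real_affine[of t ?J 0] t unfolding eq by simp
  also have "\<dots> = t powr (- r) * integral\<^sup>L lborel ?J'"
    using t powr_add[of t 1 "- 1 - r"] by simp
  finally show "(LINT x|half_line. (1 - exp (- (x * t))) * x powr (- 1 - r))
       = t powr r * (LINT x|half_line. (1 - exp (- x)) * x powr (- 1 - r))"
    using t by (simp add: integral_half_line powr_minus)
qed

lemma hankel_pd_exp_neg_powr:
  fixes r :: real
  assumes r: "0 < r" "r \<le> 1"
  shows "hankel_pd (\<lambda>t. exp (- (t powr r)))"
proof (cases "r = 1")
  case True
  have pd: "hankel_pd (\<lambda>t. exp (- t))"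
    using hankel_pd_exp_mult[OF hankel_pd_one, of 1] by simp
  \<comment> \<open>A constant sequence is used because \<open>t powr 1\<close> differs from
    \<open>t\<close> for negative \<open>t\<close>, while the limit lemma compares only on the
    positive half-line.\<close>
  show ?thesis
    by (rule hankel_pd_LIMSEQ[OF pd]) (use True in auto)
next
  case False
  with r have r1: "0 < r" "r < 1" by auto
  define K where "K = (LINT x|half_line. (1 - exp (- x)) * x powr (- 1 - r))"
  have K: "K > 0" unfolding K_def by (rule integral_one_minus_exp_powr_pos[OF r1])
  \<comment> \<open>The weight \<open>x powr (- 1 - r)\<close> has infinite mass near 0; the cut at
    \<open>1 / Suc n\<close> makes it finite, and \<open>K\<close> normalises the limit to
    \<open>t powr r\<close>.\<close>
  define k where "k n x = (if 1 / real (Suc n) \<le> x then x powr (- 1 - r) / K else 0)" for n :: nat and x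
  have km [measurable]: "k n \<in> borel_measurable borel" for n unfolding k_def by measurable
  have k0: "k n x \<ge> 0" for n x using K by (simp add: k_def)
  have ki: "integrable half_line (k n)" for n
  \<comment> \<open>The constant is the value of the weight at the cut, which is its
    maximum.\<close>
  proof (rule integrable_half_line_cut_bound[where C = "real (Suc n) powr (1 + r) / K" and a = 0 and b = "- 1 - r"])
    fix x :: real assume x: "0 < x" "x \<le> 1"
    have "x powr (- 1 - r) \<le> real (Suc n) powr (1 + r)" if "1 / real (Suc n) \<le> x"
    proof -
      have "x powr (- 1 - r) \<le> (1 / real (Suc n)) powr (- 1 - r)"
        by (rule powr_mono2') (use that r in auto)
      also have "\<dots> = real (Suc n) powr (1 + r)"
        by (simp add: powr_divide powr_minus_divide[symmetric] add.commute del: of_nat_Suc)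
      finally show ?thesis .
    qed
    then show "norm (k n x) \<le> real (Suc n) powr (1 + r) / K * x powr 0"
      using x K by (simp add: k_def divide_right_mono del: of_nat_Suc)
  next
    fix x :: real assume x: "1 < x"
    have "1 \<le> real (Suc n) powr (1 + r)" by (rule ge_one_powr_ge_zero) (use r in auto)
    then have "1 * x powr (- 1 - r) \<le> real (Suc n) powr (1 + r) * x powr (- 1 - r)"
      by (rule mult_right_mono) simp
    then show "norm (k n x) \<le> real (Suc n) powr (1 + r) / K * x powr (- 1 - r)"
      using x K by (simp add: k_def divide_right_mono del: of_nat_Suc)
  qed (use r in auto)
  show ?thesis
  proof (rule hankel_pd_LIMSEQ)
    show "hankel_pd (\<lambda>t. exp (laplace (k n) t - integral\<^sup>L half_line (k n)))" for n
      by (rule hankel_pd_exp_laplace[OF ki k0])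
    fix t :: real assume t: "t > 0"
    let ?L = "\<lambda>x. (1 - exp (- (x * t))) * x powr (- 1 - r) / K"
    \<comment> \<open>The masses diverge as \<open>n\<close> grows, but in the difference the factor
      \<open>1 - exp (- (x * t))\<close> compensates the singularity at 0, so the limit
      exists.\<close>
    have diff: "laplace (k n) t - integral\<^sup>L half_line (k n) = - (LINT x|half_line. k n x * (1 - exp (- (x * t))))" for n
      unfolding laplace_def using integrable_laplace[OF ki t] ki
      by (subst Bochner_Integration.integral_diff[symmetric])
        (auto simp: algebra_simps simp flip: Bochner_Integration.integral_minus)
    have "(\<lambda>n. LINT x|half_line. k n x * (1 - exp (- (x * t)))) \<longlonglongrightarrow> (LINT x|half_line. ?L x)"
    proof (rule integral_dominated_convergence)
      show "integrable half_line ?L"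
        using scaled_one_minus_exp_powr(1)[OF r1 t] by simp
      show "AE x in half_line. (\<lambda>n. k n x * (1 - exp (- (x * t)))) \<longlonglongrightarrow> ?L x"
      proof (rule AE_half_lineI)
        fix x :: real assume x: "x > 0"
        have "eventually (\<lambda>n. 1 / real (Suc n) < x) sequentially"
          using order_tendstoD(2)[OF LIMSEQ_inverse_real_of_nat x] by (simp add: inverse_eq_divide)
        then have "eventually (\<lambda>n. k n x * (1 - exp (- (x * t))) = ?L x) sequentially"
          by eventually_elim (simp add: k_def)
        then show "(\<lambda>n. k n x * (1 - exp (- (x * t)))) \<longlonglongrightarrow> ?L x"
          by (rule tendsto_eventually)
      qed
      show "AE x in half_line. norm (k n x * (1 - exp (- (x * t)))) \<le> ?L x" for n
        using K t by (intro AE_half_lineI) (auto simp: k_def mult.commute)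
    qed measurable
    also have "(LINT x|half_line. ?L x) = t powr r"
      using scaled_one_minus_exp_powr(2)[OF r1 t] K by (simp add: K_def)
    finally show "(\<lambda>n. exp (laplace (k n) t - integral\<^sup>L half_line (k n))) \<longlonglongrightarrow> exp (- (t powr r))"
      unfolding diff by (intro tendsto_intros)
  qed measurable
qed

subsection \<open>Hankel operators with dominated kernel\<close>

lemma L2_spaceD:
  assumes "f \<in> L2_space"
  shows "f \<in> borel_measurable half_line" "integrable half_line (\<lambda>t. (cmod (f t))\<^sup>2)"
  using assms by (auto simp: L2_space_def)

text \<open>On a set of finite length, \<open>1 + x\<^sup>2\<close> with
  \<open>x = cmod (f t)\<close> is an integrable majorant. Thus truncations are admissible test
  functions for \<open>hankel_pd\<close>.\<close>

lemma integrable_truncation: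
  assumes f: "f \<in> L2_space" and c: "c \<ge> 0"
  shows "integrable half_line (\<lambda>t. indicator {0<..c} t *\<^sub>R f t)"
proof (rule Bochner_Integration.integrable_bound)
  have [measurable]: "f \<in> borel_measurable half_line" using f by (rule L2_spaceD)
  show "(\<lambda>t. indicator {0<..c} t *\<^sub>R f t) \<in> borel_measurable half_line" by measurable
  show "integrable half_line (\<lambda>t. indicator {0<..c} t + (cmod (f t))\<^sup>2)"
    using L2_spaceD(2)[OF f] half_line_Ioc(1)[of 0 c] c by simp
  have "x \<le> 1 + x\<^sup>2" for x :: real
    using sum_squares_bound[of 1 x] zero_le_power2[of x] by (simp only: one_power2)
  then show "AE t in half_line. norm (indicator {0<..c} t *\<^sub>R f t) \<le> norm (indicator {0<..c} t + (cmod (f t))\<^sup>2)"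
    by (intro AE_half_lineI) (auto simp: indicator_def)
qed

locale dominated_hankel =
  fixes h w :: "real \<Rightarrow> real"
  assumes h_measurable [measurable]: "h \<in> borel_measurable borel"
    and w_measurable [measurable]: "w \<in> borel_measurable borel"
    and w_nonneg: "\<And>t. 0 \<le> w t"
    and w_square: "integrable half_line (\<lambda>t. (w t)\<^sup>2)"
    and h_le: "\<And>t s. t > 0 \<Longrightarrow> s > 0 \<Longrightarrow> \<bar>h (t + s)\<bar> \<le> w t * w s"
begin

lemma integrable_weighted:
  assumes f: "f \<in> L2_space"
  shows "integrable half_line (\<lambda>t. w t * cmod (f t))"
proof -
  have [measurable]: "f \<in> borel_measurable half_line" using f by (rule L2_spaceD)
  show ?thesis by (rule integrable_prod_square[OF _ _ w_square L2_spaceD(2)[OF f]]) measurable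
qed

lemma integrable_kernel:
  assumes f: "f \<in> L2_space" and t: "t > 0"
  shows "integrable half_line (\<lambda>s. complex_of_real (h (t + s)) * f s)"
proof (rule Bochner_Integration.integrable_bound)
  have [measurable]: "f \<in> borel_measurable half_line" using f by (rule L2_spaceD)
  show "(\<lambda>s. complex_of_real (h (t + s)) * f s) \<in> borel_measurable half_line" by measurable
  show "integrable half_line (\<lambda>s. w t * (w s * cmod (f s)))"
    using integrable_weighted[OF f] by simp
  show "AE s in half_line. norm (complex_of_real (h (t + s)) * f s) \<le> norm (w t * (w s * cmod (f s)))"
    using h_le[OF t] w_nonneg
    by (intro AE_half_lineI) (auto simp: norm_mult abs_mult mult.assoc[symmetric] intro!: mult_right_mono)
qed

lemma norm_hankel_le:
  assumes f: "f \<in> L2_space" and t: "t > 0"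
  shows "cmod (hankel h f t) \<le> w t * (LINT s|half_line. w s * cmod (f s))"
proof -
  have "cmod (hankel h f t) \<le> (LINT s|half_line. w t * (w s * cmod (f s)))"
    unfolding hankel_def
  proof (rule Bochner_Integration.integral_norm_bound_integral[OF integrable_kernel[OF f t]])
    show "integrable half_line (\<lambda>s. w t * (w s * cmod (f s)))"
      using integrable_weighted[OF f] by simp
    show "norm (complex_of_real (h (t + s)) * f s) \<le> w t * (w s * cmod (f s))"
      if "s \<in> space half_line" for s
      using h_le[OF t] that by (auto simp: norm_mult mult.assoc[symmetric] intro!: mult_right_mono)
  qed
  then show ?thesis by simp
qed

lemma hankel_measurable [measurable]:
  assumes [measurable]: "f \<in> borel_measurable half_line"
  shows "hankel h f \<in> borel_measurable half_line"
  unfolding hankel_def by measurable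

text \<open>Pointwise, \<open>hankel h f\<close> is at most \<open>w\<close> times the weighted
  integral of \<open>f\<close>; Cauchy-Schwarz for that integral contributes the second factor of
  the norm of \<open>w\<close>.\<close>

lemma hankel_L2:
  assumes f: "f \<in> L2_space"
  shows "hankel h f \<in> L2_space" "L2_nrm (hankel h f) \<le> (LINT t|half_line. (w t)\<^sup>2) * L2_nrm f"
proof -
  have [measurable]: "f \<in> borel_measurable half_line" using f by (rule L2_spaceD)
  define I where "I = (LINT s|half_line. w s * cmod (f s))"
  have I0: "I \<ge> 0" unfolding I_def using w_nonneg by simp
  have le: "(cmod (hankel h f t))\<^sup>2 \<le> (w t)\<^sup>2 * I\<^sup>2" if "t > 0" for t
    using power_mono[OF norm_hankel_le[OF f that], of 2] by (simp add: I_def power_mult_distrib)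
  have wI: "integrable half_line (\<lambda>t. (w t)\<^sup>2 * I\<^sup>2)" using w_square by simp
  have int: "integrable half_line (\<lambda>t. (cmod (hankel h f t))\<^sup>2)"
    by (rule Bochner_Integration.integrable_bound[OF wI]) (auto intro!: AE_half_lineI le)
  then show "hankel h f \<in> L2_space" by (simp add: L2_space_def)
  let ?W = "LINT t|half_line. (w t)\<^sup>2"
  have W0: "?W \<ge> 0" by simp
  have "(LINT t|half_line. (cmod (hankel h f t))\<^sup>2) \<le> (LINT t|half_line. (w t)\<^sup>2 * I\<^sup>2)"
    by (intro integral_mono_AE int wI AE_half_lineI le)
  also have "\<dots> = ?W * I\<^sup>2" by simp
  also have "\<dots> \<le> ?W * (?W * (LINT t|half_line. (cmod (f t))\<^sup>2))"
    using Cauchy_Schwarz_integral[OF _ _ w_square L2_spaceD(2)[OF f]] W0 w_nonneg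
    by (intro mult_left_mono) (auto simp: I_def)
  also have "\<dots> = (?W * L2_nrm f)\<^sup>2" by (simp add: L2_nrm_def power_mult_distrib power2_eq_square)
  finally show "L2_nrm (hankel h f) \<le> ?W * L2_nrm f"
    unfolding L2_nrm_def[of "hankel h f"] using W0 by (intro real_le_lsqrt) (auto simp: L2_nrm_def)
qed

lemma hankel_bounded_operator: "L2_bounded_operator (hankel h)"
  unfolding L2_bounded_operator_def
proof (intro conjI ballI allI exI)
  fix f g a b assume fg: "f \<in> L2_space" "g \<in> L2_space"
  show "AE t in half_line. hankel h (\<lambda>s. a * f s + b * g s) t = a * hankel h f t + b * hankel h g t"
  proof (rule AE_half_lineI)
    fix t :: real assume t: "t > 0"
    have "hankel h (\<lambda>s. a * f s + b * g s) t
       = (LINT s|half_line. a * (complex_of_real (h (t + s)) * f s) + b * (complex_of_real (h (t + s)) * g s))"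
      unfolding hankel_def by (simp add: algebra_simps)
    then show "hankel h (\<lambda>s. a * f s + b * g s) t = a * hankel h f t + b * hankel h g t"
      unfolding hankel_def using integrable_kernel[OF fg(1) t] integrable_kernel[OF fg(2) t] by simp
  qed
qed (use hankel_L2 in auto)

lemma integrable_quadrant_kernel:
  assumes f: "f \<in> L2_space" and g: "g \<in> L2_space"
  shows "integrable quadrant (\<lambda>(t, s). complex_of_real (h (t + s)) * f s * cnj (g t))"
proof (rule Bochner_Integration.integrable_bound)
  have [measurable]: "f \<in> borel_measurable half_line" "g \<in> borel_measurable half_line"
    using f g by (auto dest: L2_spaceD)
  have [measurable]: "cnj \<in> borel_measurable borel" by (intro borel_measurable_continuous_onI continuous_intros)
  show "(\<lambda>(t, s). complex_of_real (h (t + s)) * f s * cnj (g t)) \<in> borel_measurable quadrant"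
    unfolding case_prod_beta by measurable
  show "integrable quadrant (\<lambda>p. (w (fst p) * cmod (g (fst p))) * (w (snd p) * cmod (f (snd p))))"
    by (intro half_line.integrable_prod integrable_weighted f g)
  show "AE p in quadrant. norm (case p of (t, s) \<Rightarrow> complex_of_real (h (t + s)) * f s * cnj (g t))
      \<le> norm ((w (fst p) * cmod (g (fst p))) * (w (snd p) * cmod (f (snd p))))"
  proof (rule AE_quadrantI)
    fix t s :: real assume "t > 0" "s > 0"
    then have "\<bar>h (t + s)\<bar> * (cmod (f s) * cmod (g t)) \<le> w t * w s * (cmod (f s) * cmod (g t))"
      by (intro mult_right_mono h_le) auto
    then show "norm (case (t, s) of (t, s) \<Rightarrow> complex_of_real (h (t + s)) * f s * cnj (g t))
      \<le> norm ((w (fst (t, s)) * cmod (g (fst (t, s)))) * (w (snd (t, s)) * cmod (f (snd (t, s)))))"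
      using w_nonneg by (simp add: norm_mult abs_mult mult_ac)
  qed
qed

lemma L2_inner_hankel:
  assumes f: "f \<in> L2_space" and g: "g \<in> L2_space"
  shows "L2_inner (hankel h f) g = (LINT (t, s)|quadrant. complex_of_real (h (t + s)) * f s * cnj (g t))"
  using half_line.integral_fst[OF integrable_quadrant_kernel[OF f g]]
  by (simp add: L2_inner_def hankel_def)

lemma L2_inner_hankel_right:
  "L2_inner f (hankel h g) = cnj (L2_inner (hankel h g) f)"
  unfolding L2_inner_def by (subst Bochner_Integration.integral_cnj[symmetric]) (simp add: mult.commute)

text \<open>Fubini reduces the claim to the kernel being real and symmetric in \<open>t\<close> and
  \<open>s\<close>.\<close>

lemma hankel_selfadjoint: "L2_selfadjoint (hankel h)"
  unfolding L2_selfadjoint_def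
proof (intro ballI)
  fix f g assume f: "f \<in> L2_space" and g: "g \<in> L2_space"
  have "L2_inner (hankel h f) g = (LINT t|half_line. LINT s|half_line. complex_of_real (h (t + s)) * f s * cnj (g t))"
    by (simp add: L2_inner_def hankel_def)
  also have "\<dots> = (LINT s|half_line. LINT t|half_line. complex_of_real (h (t + s)) * f s * cnj (g t))"
    using half_line.Fubini_integral[OF integrable_quadrant_kernel[OF f g]] by simp
  also have "\<dots> = (LINT s|half_line. f s * cnj (hankel h g s))"
  proof (rule Bochner_Integration.integral_cong[OF refl])
    fix s
    have "(LINT t|half_line. complex_of_real (h (t + s)) * f s * cnj (g t))
      = (LINT t|half_line. f s * cnj (complex_of_real (h (s + t)) * g t))"
      by (simp add: mult_ac add.commute)
    also have "\<dots> = f s * cnj (hankel h g s)"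
      unfolding hankel_def by (subst Bochner_Integration.integral_cnj[symmetric]) simp
    finally show "(LINT t|half_line. complex_of_real (h (t + s)) * f s * cnj (g t)) = f s * cnj (hankel h g s)" .
  qed
  finally show "L2_inner (hankel h f) g = L2_inner f (hankel h g)"
    by (simp add: L2_inner_def)
qed

lemma L2_inner_hankel_real:
  assumes f: "f \<in> L2_space"
  shows "L2_inner (hankel h f) f \<in> \<real>"
proof -
  have "L2_inner (hankel h f) f = L2_inner f (hankel h f)"
    using hankel_selfadjoint f by (simp add: L2_selfadjoint_def)
  then have "cnj (L2_inner (hankel h f) f) = L2_inner (hankel h f) f"
    using L2_inner_hankel_right[of f f] by metis
  then show ?thesis by (simp add: Reals_cnj_iff)
qed

lemma Re_L2_inner_hankel:
  assumes f: "f \<in> L2_space"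
  shows "Re (L2_inner (hankel h f) f) = hankel_form h f"
proof -
  have "Re (L2_inner (hankel h f) f) = (LINT p|quadrant. Re (case p of (t, s) \<Rightarrow> complex_of_real (h (t + s)) * f s * cnj (f t)))"
    unfolding L2_inner_hankel[OF f f]
    using integrable_quadrant_kernel[OF f f] by (subst integral_Re) auto
  also have "\<dots> = hankel_form h f"
    unfolding hankel_form_def
    by (rule Bochner_Integration.integral_cong) (auto simp: inner_complex_def algebra_simps split: prod.splits)
  finally show ?thesis .
qed

lemma L2_nonneg_hankel_iff: "L2_nonneg (hankel h) \<longleftrightarrow> (\<forall>f\<in>L2_space. 0 \<le> hankel_form h f)"
  by (simp add: L2_nonneg_def L2_inner_hankel_real Re_L2_inner_hankel)

lemma L2_nonpos_hankel_iff: "L2_nonpos (hankel h) \<longleftrightarrow> (\<forall>f\<in>L2_space. hankel_form h f \<le> 0)"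
  by (simp add: L2_nonpos_def L2_inner_hankel_real Re_L2_inner_hankel)

text \<open>Passes from integrable to square integrable test functions: truncations to (0, n] are
  integrable, and their forms converge under the majorant built from \<open>w\<close>.\<close>

lemma L2_nonneg_hankel_pd:
  assumes pd: "hankel_pd h"
  shows "L2_nonneg (hankel h)"
  unfolding L2_nonneg_hankel_iff
proof
  fix f assume f: "f \<in> L2_space"
  have [measurable]: "f \<in> borel_measurable half_line" using f by (rule L2_spaceD)
  define F where "F n t = indicator {0<..real n} t *\<^sub>R f t" for n :: nat and t
  have [measurable]: "F n \<in> borel_measurable half_line" for n unfolding F_def by measurable
  have Fle: "norm (F n t) \<le> norm (f t)" for n t by (auto simp: F_def indicator_def)
  have Flim: "(\<lambda>n. F n t) \<longlonglongrightarrow> f t" if "t > 0" for t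
  proof -
    have "eventually (\<lambda>n. t \<le> real n) sequentially"
      using eventually_ge_at_top[of "nat \<lceil>t\<rceil>"] by eventually_elim linarith
    then have "eventually (\<lambda>n. F n t = f t) sequentially"
      by eventually_elim (use that in \<open>simp add: F_def\<close>)
    then show ?thesis by (rule tendsto_eventually)
  qed
  have "(\<lambda>n. hankel_form h (F n)) \<longlonglongrightarrow> hankel_form h f"
    unfolding hankel_form_def
  proof (rule integral_dominated_convergence)
    show "integrable quadrant (\<lambda>p. (w (fst p) * cmod (f (fst p))) * (w (snd p) * cmod (f (snd p))))"
      by (intro half_line.integrable_prod integrable_weighted f)
    show "AE p in quadrant. (\<lambda>n. h (fst p + snd p) * (F n (fst p) \<bullet> F n (snd p)))
        \<longlonglongrightarrow> h (fst p + snd p) * (f (fst p) \<bullet> f (snd p))"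
      by (intro AE_quadrantI tendsto_intros Flim) auto
    show "AE p in quadrant. norm (h (fst p + snd p) * (F n (fst p) \<bullet> F n (snd p)))
        \<le> (w (fst p) * cmod (f (fst p))) * (w (snd p) * cmod (f (snd p)))" for n
    proof (rule AE_quadrantI)
      fix t s :: real assume ts: "t > 0" "s > 0"
      have "\<bar>F n t \<bullet> F n s\<bar> \<le> norm (f t) * norm (f s)"
        by (rule order_trans[OF Cauchy_Schwarz_ineq2]) (auto intro!: mult_mono Fle)
      then have "\<bar>h (t + s)\<bar> * \<bar>F n t \<bullet> F n s\<bar> \<le> (w t * w s) * (norm (f t) * norm (f s))"
        by (intro mult_mono h_le ts) (auto simp: w_nonneg)
      then show "norm (h (fst (t, s) + snd (t, s)) * (F n (fst (t, s)) \<bullet> F n (snd (t, s))))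
        \<le> (w (fst (t, s)) * cmod (f (fst (t, s)))) * (w (snd (t, s)) * cmod (f (snd (t, s))))"
        by (simp add: abs_mult mult_ac)
    qed
  qed measurable
  moreover have "0 \<le> hankel_form h (F n)" for n
    using pd integrable_truncation[OF f, of "real n"] by (simp add: hankel_pd_def F_def[abs_def])
  ultimately show "0 \<le> hankel_form h f"
    by (intro LIMSEQ_le_const) auto
qed

end

subsection \<open>The kernel \<open>exp (- (t powr r))\<close>\<close>

lemma dominated_hankel_exp_neg_powr:
  fixes r :: real
  assumes r: "r > 0"
  shows "dominated_hankel (\<lambda>t. exp (- (t powr r))) (\<lambda>t. exp (- (t powr r) / 2))"
proof
  show "integrable half_line (\<lambda>t. (exp (- (t powr r) / 2))\<^sup>2)"
    using integrable_exp_neg_powr[OF r] by (simp flip: exp_double)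
  fix t s :: real assume ts: "t > 0" "s > 0"
  \<comment> \<open>Averaging these two inequalities gives the exponent of the rank one
    majorant.\<close>
  have "t powr r \<le> (t + s) powr r" "s powr r \<le> (t + s) powr r"
    using ts r by (auto intro!: powr_mono2)
  then show "\<bar>exp (- ((t + s) powr r))\<bar> \<le> exp (- (t powr r) / 2) * exp (- (s powr r) / 2)"
    by (simp flip: exp_add)
qed auto

section \<open>Step functions as test functions\<close>

lemma step_combination_L2:
  fixes a b c d \<alpha> \<beta> :: real
  assumes "0 \<le> a" "a \<le> b" "0 \<le> c" "c \<le> d"
  shows "(\<lambda>t. complex_of_real (\<alpha> * indicator {a<..b} t + \<beta> * indicator {c<..d} t)) \<in> L2_space"
proof -
  let ?u = "\<lambda>t. \<alpha> * indicator {a<..b} t + \<beta> * indicator {c<..d} t"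
  have "integrable half_line (\<lambda>t. (?u t)\<^sup>2)"
  proof (rule Bochner_Integration.integrable_bound)
    show "integrable half_line (\<lambda>t. 2 * \<alpha>\<^sup>2 * indicator {a<..b} t + 2 * \<beta>\<^sup>2 * indicator {c<..d} t)"
      using half_line_Ioc(1) assms by simp
    have "(x + y)\<^sup>2 \<le> 2 * x\<^sup>2 + 2 * y\<^sup>2" for x y :: real
      using sum_squares_bound[of x y] by (simp add: power2_sum)
    then show "AE t in half_line. norm ((?u t)\<^sup>2)
        \<le> norm (2 * \<alpha>\<^sup>2 * indicator {a<..b} t + 2 * \<beta>\<^sup>2 * indicator {c<..d} t)"
      by (intro AE_half_lineI) (auto simp: indicator_def)
  qed measurable
  moreover have "(\<lambda>t. complex_of_real (?u t)) \<in> borel_measurable half_line" by measurable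
  ultimately show ?thesis by (simp only: L2_space_def mem_Collect_eq norm_of_real power2_abs)
qed

text \<open>For the indicator of (0, 1] only arguments \<open>t + s \<le> 2\<close> occur, so the
  decreasing kernel is at least its value at 2 and the form is at least that positive value.\<close>

lemma hankel_form_exp_neg_powr_pos:
  fixes r :: real
  assumes r: "r > 0"
  obtains f where "f \<in> L2_space" "0 < hankel_form (\<lambda>t. exp (- (t powr r))) f"
proof
  let ?h = "\<lambda>t. exp (- (t powr r))" and ?u = "indicator {0<..1::real} :: real \<Rightarrow> real"
  interpret dominated_hankel ?h "\<lambda>t. exp (- (t powr r) / 2)"
    by (rule dominated_hankel_exp_neg_powr[OF r])
  show L: "(\<lambda>t. complex_of_real (?u t)) \<in> L2_space"
    using step_combination_L2[of 0 1 0 1 1 0] by simp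
  have "0 < ?h 2 * ((LINT t|half_line. ?u t) * (LINT t|half_line. ?u t))"
    by (subst (1 2) half_line_Ioc(2)) auto
  also have "\<dots> = (LINT p|quadrant. ?h 2 * (?u (fst p) * ?u (snd p)))"
    by (simp add: half_line.integral_prod half_line_Ioc)
  also have "\<dots> \<le> hankel_form ?h (\<lambda>t. complex_of_real (?u t))"
    unfolding hankel_form_def
  proof (rule integral_mono_AE)
    show "integrable quadrant (\<lambda>p. ?h 2 * (?u (fst p) * ?u (snd p)))"
      by (intro integrable_mult_right half_line.integrable_prod half_line_Ioc) auto
    show "integrable quadrant (\<lambda>p. ?h (fst p + snd p) * (complex_of_real (?u (fst p)) \<bullet> complex_of_real (?u (snd p))))"
      by (rule integrable_hankel_integrand) (auto simp: half_line_Ioc)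
    have "?h 2 \<le> ?h (t + s)" if "t > 0" "s > 0" "t \<le> 1" "s \<le> 1" for t s
      using that r by (auto intro!: powr_mono2)
    then show "AE p in quadrant. ?h 2 * (?u (fst p) * ?u (snd p))
        \<le> ?h (fst p + snd p) * (complex_of_real (?u (fst p)) \<bullet> complex_of_real (?u (snd p)))"
      by (intro AE_quadrantI) (auto simp: indicator_def)
  qed
  finally show "0 < hankel_form ?h (\<lambda>t. complex_of_real (?u t))" .
qed

text \<open>
  Positivity of the form would force \<open>h 0 * h 2 \<ge> (h 1)\<^sup>2\<close>, by testing on approximations of
  \<open>h 1 \<cdot> \<delta>\<^sub>0 - \<delta>\<^sub>1\<close>; for \<open>r > 1\<close> this fails because \<open>2 powr r > 2\<close>.
\<close>

lemma hankel_form_exp_neg_powr_neg: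
  fixes r :: real
  assumes r: "r > 1"
  obtains f where "f \<in> L2_space" "hankel_form (\<lambda>t. exp (- (t powr r))) f < 0"
proof -
  let ?h = "\<lambda>t. exp (- (t powr r))"
  define a where "a = ?h 1"
  have a0: "a > 0" by (simp add: a_def)
  have anti: "?h y \<le> ?h x" if "0 \<le> x" "x \<le> y" for x y
    using that r by (auto intro!: powr_mono2)
  \<comment> \<open>For the step function on intervals of length \<open>e\<close> chosen below, this
    expression times \<open>e\<^sup>2\<close> bounds the form from above. Its limit is
    \<open>?h 2 - a\<^sup>2\<close>, because \<open>?h 1 = a\<close>.\<close>
  have "((\<lambda>e. a\<^sup>2 - 2 * a * ?h (1 + 2 * e) + ?h 2) \<longlongrightarrow> a\<^sup>2 - 2 * a * ?h (1 + 2 * 0) + ?h 2) (at_right 0)"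
    by (intro tendsto_intros) auto
  moreover have "a\<^sup>2 - 2 * a * ?h (1 + 2 * 0) + ?h 2 < 0"
  proof -
    have "2 powr r > (2::real)" using powr_less_mono[of 1 r 2] r by simp
    then have "?h 2 < exp (- 1 + - 1)" by simp
    also have "\<dots> = a\<^sup>2" unfolding exp_add by (simp add: a_def power2_eq_square)
    finally show ?thesis by (simp add: a_def power2_eq_square)
  qed
  ultimately have "eventually (\<lambda>e. a\<^sup>2 - 2 * a * ?h (1 + 2 * e) + ?h 2 < 0) (at_right 0)"
    by (rule order_tendstoD(2))
  \<comment> \<open>The condition \<open>e < 1\<close> keeps the two intervals of the test function
    disjoint.\<close>
  moreover have "eventually (\<lambda>e. 0 < e \<and> e < 1) (at_right (0::real))"
    unfolding eventually_at_right_field by (rule exI[of _ 1]) auto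
  ultimately have "eventually (\<lambda>e. a\<^sup>2 - 2 * a * ?h (1 + 2 * e) + ?h 2 < 0 \<and> 0 < e \<and> e < 1) (at_right 0)"
    by (rule eventually_conj)
  then obtain e where e: "a\<^sup>2 - 2 * a * ?h (1 + 2 * e) + ?h 2 < 0" "0 < e" "e < 1"
    using eventually_happens'[OF trivial_limit_at_right_real] by blast
  let ?A = "indicator {0<..e} :: real \<Rightarrow> real" and ?B = "indicator {1<..1 + e} :: real \<Rightarrow> real"
  define f where "f t = complex_of_real (a * ?A t + (- 1) * ?B t)" for t
  have L: "f \<in> L2_space"
    unfolding f_def using e by (intro step_combination_L2) auto
  have f1: "integrable half_line f"
    unfolding f_def
    by (intro integrable_of_real Bochner_Integration.integrable_add integrable_mult_right half_line_Ioc)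
      (use e in auto)
  have A: "integrable half_line ?A" "integral\<^sup>L half_line ?A = e"
    and B: "integrable half_line ?B" "integral\<^sup>L half_line ?B = e"
    using half_line_Ioc[of 0 e] half_line_Ioc[of 1 "1 + e"] e by auto
  note P = half_line.integrable_prod[OF A(1) A(1)] half_line.integrable_prod[OF A(1) B(1)]
     half_line.integrable_prod[OF B(1) A(1)] half_line.integrable_prod[OF B(1) B(1)]
  \<comment> \<open>On each rectangle the kernel is replaced by a constant in the direction that
    increases the integrand: the upper bounds 1 and \<open>?h 2\<close> on the two squares, and the
    lower bound \<open>?h (1 + 2 * e)\<close> on the mixed rectangles, where the coefficient
    \<open>- a\<close> is negative.\<close>
  define G where "G p = a\<^sup>2 * (?A (fst p) * ?A (snd p))
      + (- (a * ?h (1 + 2 * e)) * (?A (fst p) * ?B (snd p))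
      + (- (a * ?h (1 + 2 * e)) * (?B (fst p) * ?A (snd p)) + ?h 2 * (?B (fst p) * ?B (snd p))))" for p
  have G: "integrable quadrant G"
    unfolding G_def by (intro Bochner_Integration.integrable_add integrable_mult_right P)
  have "hankel_form ?h f \<le> integral\<^sup>L quadrant G"
    unfolding hankel_form_def
  proof (rule integral_mono_AE[OF _ G])
    show "integrable quadrant (\<lambda>p. ?h (fst p + snd p) * (f (fst p) \<bullet> f (snd p)))"
      by (rule integrable_hankel_integrand) (auto simp: f1)
    show "AE p in quadrant. ?h (fst p + snd p) * (f (fst p) \<bullet> f (snd p)) \<le> G p"
    proof (rule AE_quadrantI)
      fix t s :: real assume ts: "t > 0" "s > 0"
      have cases: "?A x = 1 \<and> ?B x = 0 \<and> x \<le> e \<or> ?A x = 0 \<and> ?B x = 1 \<and> 1 < x \<and> x \<le> 1 + e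
          \<or> ?A x = 0 \<and> ?B x = 0" if "x > 0" for x
        using that e by (auto simp: indicator_def)
      have AA: "?h (t + s) * a\<^sup>2 \<le> a\<^sup>2"
        by (intro mult_left_le_one_le) auto
      have AB: "a * ?h (1 + 2 * e) \<le> ?h (t + s) * a" if "t + s \<le> 1 + 2 * e"
        using that ts a0 by (subst mult.commute) (intro mult_right_mono anti, auto)
      have BB: "?h (t + s) \<le> ?h 2" if "t > 1" "s > 1"
        using that by (intro anti) auto
      have f_inner: "f t \<bullet> f s = (a * ?A t - ?B t) * (a * ?A s - ?B s)"
        by (simp add: f_def inner_complex_def)
      show "?h (fst (t, s) + snd (t, s)) * (f (fst (t, s)) \<bullet> f (snd (t, s))) \<le> G (t, s)"
        unfolding fst_conv snd_conv f_inner G_def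
        using cases[OF ts(1)] cases[OF ts(2)]
        by (elim disjE conjE) (use AA AB BB in \<open>simp_all add: power2_eq_square\<close>)
    qed
  qed
  also have "integral\<^sup>L quadrant G = a\<^sup>2 * (e * e)
      + (- (a * ?h (1 + 2 * e)) * (e * e) + (- (a * ?h (1 + 2 * e)) * (e * e) + ?h 2 * (e * e)))"
    unfolding G_def
    by (simp only: Bochner_Integration.integral_add Bochner_Integration.integrable_add
        integrable_mult_right P integral_mult_right_zero half_line.integral_prod A B)
  also have "\<dots> = e\<^sup>2 * (a\<^sup>2 - 2 * a * ?h (1 + 2 * e) + ?h 2)"
    by (simp add: power2_eq_square algebra_simps)
  also have "\<dots> < 0"
    using e by (intro mult_pos_neg) auto
  finally show ?thesis using L that by blast
qed

theorem proposition5p6: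
  fixes r :: real
    and h :: "real \<Rightarrow> real"
    and H :: "(real \<Rightarrow> complex) \<Rightarrow> real \<Rightarrow> complex"
  assumes "r > 0"
    and "h = (\<lambda>t. exp (- (t powr r)))"
    and "H = hankel h"
  shows "(\<forall>f\<in>L2_space. \<forall>t>0. integrable half_line (\<lambda>s. complex_of_real (h (t + s)) * f s))
    \<and> L2_bounded_operator H
    \<and> L2_selfadjoint H
    \<and> (r \<le> 1 \<longrightarrow> L2_nonneg H)
    \<and> (r > 1 \<longrightarrow> L2_not_sign_definite H)"
proof -
  interpret dominated_hankel h "\<lambda>t. exp (- (t powr r) / 2)"
    unfolding assms(2) by (rule dominated_hankel_exp_neg_powr[OF assms(1)])
  have "L2_nonneg H" if "r \<le> 1"
    unfolding assms(3) using hankel_pd_exp_neg_powr[OF assms(1) that]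
    by (intro L2_nonneg_hankel_pd) (simp add: assms(2))
  moreover have "L2_not_sign_definite H" if r: "r > 1"
  proof -
    obtain f where "f \<in> L2_space" "0 < hankel_form h f"
      using hankel_form_exp_neg_powr_pos[OF assms(1)] unfolding assms(2) by blast
    moreover obtain g where "g \<in> L2_space" "hankel_form h g < 0"
      using hankel_form_exp_neg_powr_neg[OF r] unfolding assms(2) by blast
    ultimately show ?thesis
      unfolding L2_not_sign_definite_def assms(3) L2_nonneg_hankel_iff L2_nonpos_hankel_iff
      by (meson not_le)
  qed
  ultimately show ?thesis
    using integrable_kernel hankel_bounded_operator hankel_selfadjoint by (simp add: assms(3))
qed

end
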